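(* Let $G=(V,E)$ be a finite, connected graph with at least two vertices. If $f:\mathbb{R}_{\geq 0} \rightarrow \mathbb{R}$ is a strictly convex and monotonically increasing function, then any probability measure $\mu$ on the vertices $V$ that maximizes $$ \sum_{v,w \in V} f(d(v,w))\, \mu(v)\, \mu(w) $$ among all probability measures on $V$ is supported in the boundary, that is, $\mathrm{supp}(\mu) \subseteq \partial G$.
   Context: Graphs are undirected and simple; $d(\cdot,\cdot)$ is the graph (shortest path) distance and $\deg(v)$ is the number of neighbors of $v$. The sum runs over all ordered pairs $(v,w)\in V\times V$, and $\mathrm{supp}(\mu)=\{v\in V:\mu(v)>0\}$. The boundary $\partial G \subseteq V$ is defined as follows: $v \in \partial G$ if and only if there exists another vertex $w \in V$ such that $$ \frac{1}{\deg(v)} \sum_{(v,x) \in E} d(x,w) < d(v,w),$$ where this sum runs over all neighbors $x$ of $v$. *)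

theory Defs
  imports
    "HOL-Probability.Probability_Mass_Function"
    "Graph_Theory.Digraph_Component"
    "Graph_Theory.Shortest_Path"
begin

(* In Graph_Theory, the locale graph describes finite simple undirected graphs: finite,
   loop-free digraphs without parallel arcs whose set of arcs is symmetric. *)

definition neighbors :: "('a, 'b) pre_digraph \<Rightarrow> 'a \<Rightarrow> 'a set" where
  "neighbors G v = {x. v \<rightarrow>\<^bsub>G\<^esub> x}"

definition deg :: "('a, 'b) pre_digraph \<Rightarrow> 'a \<Rightarrow> nat" where
  "deg G v = card (neighbors G v)"

(* The least number of arcs of a walk from v to w. The extended real is finite whenever w is
   reachable from v; for unreachable w, real_of_ereal would return 0, so gdist is meaningful
   only on connected graphs. *)
definition gdist :: "('a, 'b) pre_digraph \<Rightarrow> 'a \<Rightarrow> 'a \<Rightarrow> real" where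
  "gdist G v w = real_of_ereal (wf_digraph.\<mu> G (\<lambda>_. 1) v w)"

definition boundary :: "('a, 'b) pre_digraph \<Rightarrow> 'a set" where
  "boundary G = {v \<in> verts G. \<exists>w \<in> verts G. w \<noteq> v \<and>
     1 / real (deg G v) * (\<Sum>x \<in> neighbors G v. gdist G x w) < gdist G v w}"

definition strictly_convex_on :: "real set \<Rightarrow> (real \<Rightarrow> real) \<Rightarrow> bool" where
  "strictly_convex_on S f \<longleftrightarrow> convex S \<and>
     (\<forall>x \<in> S. \<forall>y \<in> S. \<forall>t. x \<noteq> y \<longrightarrow> 0 < t \<longrightarrow> t < 1 \<longrightarrow>
        f ((1 - t) * x + t * y) < (1 - t) * f x + t * f y)"

definition energy :: "(real \<Rightarrow> real) \<Rightarrow> ('a, 'b) pre_digraph \<Rightarrow> 'a pmf \<Rightarrow> real" where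
  "energy f G \<mu> = (\<Sum>v \<in> verts G. \<Sum>w \<in> verts G. f (gdist G v w) * pmf \<mu> v * pmf \<mu> w)"

end

theory Submission
  imports Defs
begin

text \<open>
  Write \<open>K v w = f (gdist G v w)\<close>, a symmetric kernel, and suppose that \<open>v\<close> is a vertex of
  mass \<open>m > 0\<close> off the boundary. Move all of this mass away, spreading it uniformly over the
  neighbors of \<open>v\<close>. Let \<open>h w\<close> be the amount by which the average of \<open>K x w\<close> over the neighbors
  \<open>x\<close> of \<open>v\<close> exceeds \<open>K v w\<close>, and let \<open>A\<close> be the average of \<open>h\<close> over the neighbors of \<open>v\<close>. As the
  energy is a quadratic form in \<open>\<mu>\<close>, it changes by
  \<open>2 * m * (\<Sum>w. pmf \<mu> w * h w) + m\<^sup>2 * (A - h v)\<close> (\<open>quadratic_form_add\<close>).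

  The point is that \<open>h\<close> is nowhere negative: since \<open>v\<close> is off the boundary, its neighbors are on
  average at least as far from \<open>w\<close> as \<open>v\<close> is, and convexity together with monotonicity
  carries this over from distances to their values under \<open>f\<close> (\<open>average_ge_off_boundary\<close>).
  At \<open>v\<close> itself, all neighbors have distance \<open>1\<close>, so that \<open>h v = f 1 - f 0\<close>, which is positive
  because a strictly convex monotone function is strictly increasing. Keeping only the summand of
  \<open>v\<close>, the first term is at least \<open>2 * m\<^sup>2 * h v\<close>, while the second is at least \<open>- m\<^sup>2 * h v\<close>.
  The energy thus grows by at least \<open>m\<^sup>2 * h v > 0\<close>, and \<open>\<mu>\<close> is not a maximizer.
\<close>

section \<open>Convex and monotone functions\<close>

lemma strictly_convex_on_imp_convex_on:
  assumes "strictly_convex_on S f"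
  shows "convex_on S f"
proof (rule convex_onI)
  fix t x y :: real
  assume t: "0 < t" "t < 1" and xy: "x \<in> S" "y \<in> S"
  show "f ((1 - t) *\<^sub>R x + t *\<^sub>R y) \<le> (1 - t) * f x + t * f y"
  proof (cases "x = y")
    case True
    then show ?thesis by (simp add: algebra_simps)
  next
    case False
    then show ?thesis
      using assms t xy by (auto simp: strictly_convex_on_def intro!: less_imp_le)
  qed
qed (use assms in \<open>simp add: strictly_convex_on_def\<close>)

text \<open>
  Monotonicity compares the left endpoint with the midpoint, and strict convexity puts the
  value at the midpoint strictly below the mean of the values at the endpoints.
\<close>
lemma strictly_convex_mono_strict_mono_on:
  assumes "strictly_convex_on S f" and "mono_on S f"
  shows "strict_mono_on S f"
proof (rule strict_mono_onI)
  fix x y assume xy: "x \<in> S" "y \<in> S" "x < y"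
  let ?z = "(1 - 1/2) * x + 1/2 * y"
  have "convex S"
    using assms(1) by (simp add: strictly_convex_on_def)
  then have "?z \<in> S"
    using convexD_alt[of S x y "1/2"] xy by simp
  then have "f x \<le> f ?z"
    using xy by (intro mono_onD[OF assms(2)]) auto
  also have "f ?z < (1 - 1/2) * f x + 1/2 * f y"
    using assms(1) xy unfolding strictly_convex_on_def by (smt (verit) field_sum_of_halves)
  finally show "f x < f y" by simp
qed

text \<open>
  Jensen's inequality for the uniform weights on \<open>A\<close>, with monotonicity used to pass from the mean
  of \<open>d\<close> to a number \<open>c\<close> below it.
\<close>
lemma jensen_mono:
  fixes f :: "real \<Rightarrow> real"
  assumes "finite A" "A \<noteq> {}" "convex_on S f" "mono_on S f"
    and "\<And>x. x \<in> A \<Longrightarrow> d x \<in> S" "c \<in> S"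
    and "c \<le> (\<Sum>x\<in>A. d x) / card A"
  shows "f c \<le> (\<Sum>x\<in>A. f (d x)) / card A"
proof -
  let ?m = "\<Sum>x\<in>A. (1 / card A) *\<^sub>R d x"
  have m: "?m = (\<Sum>x\<in>A. d x) / card A"
    by (simp add: sum_divide_distrib)
  have S: "convex S"
    using assms(3) by (rule convex_on_imp_convex)
  have card: "card A > 0"
    using assms by (simp add: card_gt_0_iff)
  have "?m \<in> S"
    using assms S card by (intro convex_sum) auto
  then have "f c \<le> f ?m"
    using assms m by (intro mono_onD[OF assms(4)]) auto
  also have "\<dots> \<le> (\<Sum>x\<in>A. (1 / card A) * f (d x))"
    using assms card by (intro convex_on_sum[of A S f]) auto
  finally show ?thesis
    by (simp add: sum_divide_distrib)
qed

section \<open>Perturbing a measure and its energy\<close>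

text \<open>
  Expansion of the quadratic form of \<open>K\<close> at \<open>p + m * s\<close>. By symmetry the two mixed terms agree,
  and both the linear and the quadratic correction are expressed through the potential
  \<open>\<lambda>w. \<Sum>v\<in>V. s v * K v w\<close> of the perturbation \<open>s\<close>.
\<close>
lemma quadratic_form_add:
  fixes K :: "'a \<Rightarrow> 'a \<Rightarrow> real"
  assumes sym: "\<And>v w. v \<in> V \<Longrightarrow> w \<in> V \<Longrightarrow> K v w = K w v"
  shows "(\<Sum>v\<in>V. \<Sum>w\<in>V. K v w * (p v + m * s v) * (p w + m * s w)) =
    (\<Sum>v\<in>V. \<Sum>w\<in>V. K v w * p v * p w)
    + 2 * m * (\<Sum>w\<in>V. p w * (\<Sum>v\<in>V. s v * K v w))
    + m\<^sup>2 * (\<Sum>w\<in>V. s w * (\<Sum>v\<in>V. s v * K v w))"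
proof -
  have swap: "(\<Sum>v\<in>V. \<Sum>w\<in>V. K v w * p v * s w) = (\<Sum>w\<in>V. p w * (\<Sum>v\<in>V. s v * K v w))"
    using sym by (auto simp: sum_distrib_left mult_ac intro!: sum.cong)
  have ps: "(\<Sum>v\<in>V. \<Sum>w\<in>V. K v w * s v * p w) = (\<Sum>w\<in>V. p w * (\<Sum>v\<in>V. s v * K v w))"
    by (subst sum.swap) (simp add: sum_distrib_left mult_ac)
  have ss: "(\<Sum>v\<in>V. \<Sum>w\<in>V. K v w * s v * s w) = (\<Sum>w\<in>V. s w * (\<Sum>v\<in>V. s v * K v w))"
    by (subst sum.swap) (simp add: sum_distrib_left mult_ac)
  have "(\<Sum>v\<in>V. \<Sum>w\<in>V. K v w * (p v + m * s v) * (p w + m * s w)) =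
      (\<Sum>v\<in>V. \<Sum>w\<in>V. K v w * p v * p w)
      + m * (\<Sum>v\<in>V. \<Sum>w\<in>V. K v w * p v * s w)
      + m * (\<Sum>v\<in>V. \<Sum>w\<in>V. K v w * s v * p w)
      + m\<^sup>2 * (\<Sum>v\<in>V. \<Sum>w\<in>V. K v w * s v * s w)"
    by (simp add: sum_distrib_left sum.distrib[symmetric] power2_eq_square algebra_simps)
  then show ?thesis
    unfolding swap ps ss by simp
qed

text \<open>
  Resampling from \<open>\<sigma>\<close> whenever \<open>v\<close> is drawn moves the whole mass of \<open>v\<close> to \<open>\<sigma>\<close>; the
  perturbation of the masses is a multiple of the signed measure \<open>\<sigma>\<close> minus the point mass at \<open>v\<close>.
\<close>
lemma pmf_bind_redistribute:
  "pmf (bind_pmf \<mu> (\<lambda>u. if u = v then \<sigma> else return_pmf u)) w =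
    pmf \<mu> w + pmf \<mu> v * (pmf \<sigma> w - indicator {v} w)"
proof -
  have "pmf (bind_pmf \<mu> (\<lambda>u. if u = v then \<sigma> else return_pmf u)) w =
      measure_pmf.expectation \<mu>
        (\<lambda>u. indicator {w} u + (pmf \<sigma> w - indicator {v} w) * indicator {v} u)"
    unfolding pmf_bind
    by (intro Bochner_Integration.integral_cong) (auto simp: indicator_def pmf_return)
  also have "\<dots> = pmf \<mu> w + pmf \<mu> v * (pmf \<sigma> w - indicator {v} w)"
    by (subst Bochner_Integration.integral_add)
       (auto simp: measure_pmf_single mult.commute
         intro!: measure_pmf.integrable_const_bound[where B = 1])
  finally show ?thesis .
qed

section \<open>Distances in graphs\<close>

context wf_digraph
begin

lemma neighbors_subset_verts: "neighbors G v \<subseteq> verts G"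
  by (auto simp: neighbors_def)

lemma awalk_cost_unit: "awalk_cost (\<lambda>_. 1) p = length p"
  by (induction p) auto

lemma gdist_nonneg: "0 \<le> gdist G u v"
  unfolding gdist_def \<mu>_def awalk_cost_unit
  by (intro real_of_ereal_pos INF_greatest) simp

lemma gdist_refl:
  assumes "v \<in> verts G"
  shows "gdist G v v = 0"
proof -
  have "\<mu> (\<lambda>_. 1) v v \<le> 0"
    using min_cost_le_walk_cost[of v "[]" v "\<lambda>_. 1"] assms by (simp add: awalk_Nil_iff zero_ereal_def)
  moreover have "0 \<le> \<mu> (\<lambda>_. 1) v v"
    unfolding \<mu>_def awalk_cost_unit by (intro INF_greatest) simp
  ultimately show ?thesis
    by (simp add: gdist_def)
qed

lemma gdist_dominates:
  assumes "u \<rightarrow> v" "u \<noteq> v"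
  shows "gdist G u v = 1"
proof -
  obtain e where "e \<in> arcs G" "tail G e = u" "head G e = v"
    using assms(1) by (auto simp: arcs_ends_conv)
  then have e: "awalk u [e] v"
    by (auto simp: awalk_Cons_iff awalk_Nil_iff)
  have "\<mu> (\<lambda>_. 1) u v \<le> 1"
    using min_cost_le_walk_cost[OF e, of "\<lambda>_. 1"] by (simp add: one_ereal_def)
  moreover have "1 \<le> \<mu> (\<lambda>_. 1) u v"
    unfolding \<mu>_def awalk_cost_unit
  proof (intro INF_greatest)
    fix p assume "p \<in> {p. awalk u p v}"
    with \<open>u \<noteq> v\<close> have "length p \<ge> 1"
      by (cases p) (auto simp: awalk_Nil_iff)
    then show "1 \<le> ereal (length p)"
      by (simp add: one_ereal_def)
  qed
  ultimately have "\<mu> (\<lambda>_. 1) u v = 1"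
    by (rule antisym)
  then show ?thesis
    by (simp add: gdist_def)
qed

end

context sym_digraph
begin

lemma awalk_reverse:
  assumes "awalk u p v"
  shows "\<exists>q. awalk v q u \<and> length q = length p"
  using assms
proof (induction p arbitrary: u)
  case Nil
  then show ?case by (auto simp: awalk_Nil_iff)
next
  case (Cons e p)
  then have e: "e \<in> arcs G" "tail G e = u" and "awalk (head G e) p v"
    by (auto simp: awalk_Cons_iff)
  then obtain q where q: "awalk v q (head G e)" "length q = length p"
    using Cons.IH by blast
  obtain e' where "e' \<in> arcs G" "tail G e' = head G e" "head G e' = u"
    using e sym_arcs by (metis symmetric_conv)
  then have "awalk (head G e) [e'] u"
    by (auto simp: awalk_Cons_iff awalk_Nil_iff)
  with q show ?case
    by (intro exI[of _ "q @ [e']"]) auto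
qed

lemma gdist_commute: "gdist G u v = gdist G v u"
proof -
  have le: "\<mu> (\<lambda>_. 1) u v \<le> \<mu> (\<lambda>_. 1) v u" for u v
    unfolding \<mu>_def awalk_cost_unit
    by (intro INF_mono) (use awalk_reverse in fastforce)
  show ?thesis
    unfolding gdist_def using le[of u v] le[of v u] by simp
qed

lemma neighbors_nonempty:
  assumes "Digraph_Component.connected G" "card (verts G) \<ge> 2" "v \<in> verts G"
  shows "neighbors G v \<noteq> {}"
proof -
  have "verts G \<noteq> {v}"
    using assms(2) by auto
  then obtain w where w: "w \<in> verts G" "w \<noteq> v"
    using assms(3) by blast
  have "v \<rightarrow>\<^sup>* w"
    using symmetric_connected_imp_strongly_connected[OF sym_arcs assms(1)] assms(3) w
    by (auto elim: strongly_connectedE)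
  then obtain p where "awalk v p w"
    by (auto simp: reachable_awalk)
  with w show ?thesis
    by (cases p) (auto simp: neighbors_def awalk_Cons_iff awalk_Nil_iff arcs_ends_conv)
qed

end

section \<open>Maximizers live on the boundary\<close>

text \<open>
  For \<open>w \<noteq> v\<close> the comparison of distances is what being off the boundary means; for \<open>w = v\<close> it is
  trivial, as \<open>v\<close> has distance \<open>0\<close> from itself.
\<close>
lemma (in graph) average_ge_off_boundary:
  assumes "v \<in> verts G" "v \<notin> boundary G" "w \<in> verts G" "neighbors G v \<noteq> {}"
    and "convex_on {0..} f" "mono_on {0..} f"
  shows "f (gdist G v w) \<le> (\<Sum>x\<in>neighbors G v. f (gdist G x w)) / card (neighbors G v)"
proof (rule jensen_mono[where S = "{0..}" and f = f and c = "gdist G v w" and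
      d = "\<lambda>x. gdist G x w"])
  show "finite (neighbors G v)"
    using neighbors_subset_verts by (rule finite_subset) simp
  show "gdist G v w \<le> (\<Sum>x\<in>neighbors G v. gdist G x w) / card (neighbors G v)"
  proof (cases "w = v")
    case True
    then show ?thesis
      using assms(1) by (simp add: gdist_refl gdist_nonneg sum_nonneg)
  next
    case False
    then show ?thesis
      using assms by (auto simp: boundary_def deg_def not_less)
  qed
qed (use assms gdist_nonneg in auto)

theorem theorem6:
  fixes G :: "('a, 'b) pre_digraph" and f :: "real \<Rightarrow> real" and \<mu> :: "'a pmf"
  assumes "graph G" and "Digraph_Component.connected G" and "card (verts G) \<ge> 2"
    and "strictly_convex_on {0..} f" and "mono_on {0..} f"
    and "is_arg_max (energy f G) (\<lambda>\<nu>. set_pmf \<nu> \<subseteq> verts G) \<mu>"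
  shows "set_pmf \<mu> \<subseteq> boundary G"
proof (rule subsetI, rule ccontr)
  interpret graph G by fact
  fix v assume "v \<in> set_pmf \<mu>" and off: "v \<notin> boundary G"
  have supp: "set_pmf \<mu> \<subseteq> verts G"
    and max: "\<And>\<nu>. set_pmf \<nu> \<subseteq> verts G \<Longrightarrow> energy f G \<nu> \<le> energy f G \<mu>"
    using assms(6) by (auto simp: is_arg_max_def not_less)
  have v: "v \<in> verts G"
    using \<open>v \<in> set_pmf \<mu>\<close> supp by blast
  define N where "N = neighbors G v"
  define K where "K u w = f (gdist G u w)" for u w
  define m where "m = pmf \<mu> v"
  define s where "s w = pmf (pmf_of_set N) w - indicator {v} w" for w
  define h where "h w = (\<Sum>u\<in>verts G. s u * K u w)" for w
  define \<nu> where "\<nu> = bind_pmf \<mu> (\<lambda>u. if u = v then pmf_of_set N else return_pmf u)"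
  have "m > 0"
    using \<open>v \<in> set_pmf \<mu>\<close> by (simp add: m_def pmf_positive)
  have N: "N \<subseteq> verts G" "N \<noteq> {}"
    using neighbors_subset_verts neighbors_nonempty[OF assms(2,3) v] by (auto simp: N_def)
  then have "finite N"
    by (auto intro: finite_subset)
  have sum_s: "(\<Sum>u\<in>verts G. s u * k u) = (\<Sum>u\<in>N. k u) / card N - k v" for k :: "'a \<Rightarrow> real"
  proof -
    have "(\<Sum>u\<in>verts G. s u * k u) =
        (\<Sum>u\<in>verts G. indicator N u * k u) / card N - (\<Sum>u\<in>verts G. indicator {v} u * k u)"
      using N \<open>finite N\<close>
      by (simp add: s_def left_diff_distrib sum_subtractf flip: sum_divide_distrib)
    also have "(\<Sum>u\<in>verts G. indicator N u * k u) = (\<Sum>u\<in>N. k u)"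
      using N(1) by (simp add: indicator_def sum.If_cases Int_absorb1 if_distrib[of "\<lambda>x. x * _"] cong: if_cong)
    also have "(\<Sum>u\<in>verts G. indicator {v} u * k u) = k v"
      using v by (simp add: indicator_def if_distrib[of "\<lambda>x. x * _"] sum.delta cong: if_cong)
    finally show ?thesis .
  qed
  have conv: "convex_on {0..} f"
    using assms(4) by (rule strictly_convex_on_imp_convex_on)
  have h_nonneg: "h w \<ge> 0" if "w \<in> verts G" for w
    using average_ge_off_boundary[OF v off that _ conv assms(5)] N(2)
    by (simp add: h_def sum_s K_def N_def)
  have h_v: "h v > 0"
  proof -
    have "gdist G x v = 1" if "x \<in> N" for x
    proof -
      have "v \<rightarrow>\<^bsub>G\<^esub> x"
        using that by (simp add: N_def neighbors_def)
      then have "gdist G v x = 1"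
        by (metis gdist_dominates adj_not_same)
      then show ?thesis
        by (simp add: gdist_commute)
    qed
    then have "h v = f 1 - f 0"
      using N(2) \<open>finite N\<close> v by (simp add: h_def sum_s K_def gdist_refl)
    moreover have "f 0 < f 1"
      using strict_mono_onD[OF strictly_convex_mono_strict_mono_on[OF assms(4,5)], of 0 1] by simp
    ultimately show ?thesis
      by simp
  qed
  have "set_pmf \<nu> \<subseteq> verts G"
    unfolding \<nu>_def set_bind_pmf
  proof (rule UN_least)
    fix u assume "u \<in> set_pmf \<mu>"
    then show "set_pmf (if u = v then pmf_of_set N else return_pmf u) \<subseteq> verts G"
      using supp N(1) set_pmf_of_set[OF N(2) \<open>finite N\<close>] by (cases "u = v") auto
  qed
  then have "energy f G \<nu> \<le> energy f G \<mu>"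
    by (rule max)
  moreover have "energy f G \<nu> = energy f G \<mu> + 2 * m * (\<Sum>w\<in>verts G. pmf \<mu> w * h w)
      + m\<^sup>2 * (\<Sum>w\<in>verts G. s w * h w)"
  proof -
    have "pmf \<nu> w = pmf \<mu> w + m * s w" for w
      unfolding \<nu>_def m_def s_def by (rule pmf_bind_redistribute)
    then show ?thesis
      unfolding energy_def h_def
      using quadratic_form_add[of "verts G" K "pmf \<mu>" m s] by (simp add: K_def gdist_commute)
  qed
  \<comment> \<open>All summands are nonnegative, so the one of \<open>v\<close>, where \<open>\<mu>\<close> has mass \<open>m\<close>, is a lower bound.\<close>
  moreover have "2 * m * (\<Sum>w\<in>verts G. pmf \<mu> w * h w) \<ge> 2 * m * (m * h v)"
    unfolding m_def using v h_nonneg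
    by (intro mult_left_mono member_le_sum) auto
  moreover have "m\<^sup>2 * (\<Sum>w\<in>verts G. s w * h w) \<ge> m\<^sup>2 * (- h v)"
  proof (rule mult_left_mono)
    have "(\<Sum>w\<in>N. h w) / card N \<ge> 0"
      using N h_nonneg by (auto intro!: divide_nonneg_nonneg sum_nonneg)
    then show "- h v \<le> (\<Sum>w\<in>verts G. s w * h w)"
      by (simp add: sum_s)
  qed simp
  moreover have "m\<^sup>2 * h v > 0"
    using \<open>m > 0\<close> h_v by simp
  ultimately show False
    by (simp add: power2_eq_square algebra_simps)
qed

end
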